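(* Let $X$ be a Hausdorff completely regular topological space, let $x\in X$, and let $\{V_\alpha\}_{\alpha\in A}$ be a local subbase for the point $x$. Then $X$ is not bisequential at $x$ if and only if there exists an ideal $\mathcal{I}$ on $A$ satisfying the following conditions: (i) $\{\alpha\}\in\mathcal{I}$ for every $\alpha\in A$; (ii) the family $$\mathcal{F}_{\mathcal{I}}=\Big\{\bigcap_{\alpha\in S}V_\alpha : S\in\mathcal{I}\Big\}\cup\Big\{X\setminus\bigcap_{\alpha\in S}V_\alpha : S\in\mathcal{P}(A)\setminus\mathcal{I}\Big\}$$ has the finite intersection property; (iii) if $\{S_i\}_{i\in\omega}\subset\mathcal{I}$, then $\bigcup_{i\in\omega}S_i\neq A$.
   Context: A sequence $\{A_n\}_{n\in\omega}$ of non-empty subsets of a topological space $X$ converges to $x\in X$ if for every neighborhood $U$ of $x$ there is $n_0\in\omega$ with $A_n\subset U$ for all $n>n_0$. An ultrafilter $\mathcal{U}\subset\mathcal{P}(X)$ converges to $x$ if every neighborhood of $x$ belongs to $\mathcal{U}$. $X$ is bisequential at $x$ if every ultrafilter on $X$ converging to $x$ contains a decreasing sequence $\{U_n\}_{n\in\omega}$ converging to $x$. A local subbase for $x$ is a family of open sets containing $x$ whose finite intersections form a local base at $x$. The intersection over the empty index set is $X$. An ideal on $A$ is a family of subsets of $A$ that contains $\emptyset$, is closed under subsets and finite unions, and does not contain $A$. A family of sets has the finite intersection property if each of its finite subfamilies has non-empty intersection. *)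

theory Defs
  imports "HOL-Analysis.Analysis"
begin

text \<open>Neighbourhoods need not be open.\<close>

definition nbhd_of :: "'a topology \<Rightarrow> 'a \<Rightarrow> 'a set \<Rightarrow> bool" where
  "nbhd_of X x N \<longleftrightarrow> N \<subseteq> topspace X \<and> (\<exists>W. openin X W \<and> x \<in> W \<and> W \<subseteq> N)"

definition sets_converge_to :: "'a topology \<Rightarrow> (nat \<Rightarrow> 'a set) \<Rightarrow> 'a \<Rightarrow> bool" where
  "sets_converge_to X U x \<longleftrightarrow>
     (\<forall>n. U n \<noteq> {} \<and> U n \<subseteq> topspace X) \<and>
     (\<forall>N. nbhd_of X x N \<longrightarrow> (\<exists>n0. \<forall>n>n0. U n \<subseteq> N))"

text \<open>Filters are represented as families of subsets of a carrier set, as the type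
  \<^typ>\<open>'a filter\<close> lives on all of \<^typ>\<open>'a\<close> and includes the improper filter.
  An ultrafilter is a maximal proper filter.\<close>

definition proper_filter_on :: "'a set \<Rightarrow> 'a set set \<Rightarrow> bool" where
  "proper_filter_on T F \<longleftrightarrow>
     F \<subseteq> Pow T \<and> T \<in> F \<and> {} \<notin> F \<and>
     (\<forall>P\<in>F. \<forall>Q\<in>F. P \<inter> Q \<in> F) \<and>
     (\<forall>P\<in>F. \<forall>Q. P \<subseteq> Q \<and> Q \<subseteq> T \<longrightarrow> Q \<in> F)"

definition ultrafilter_on :: "'a set \<Rightarrow> 'a set set \<Rightarrow> bool" where
  "ultrafilter_on T F \<longleftrightarrow>
     proper_filter_on T F \<and> (\<forall>G. proper_filter_on T G \<and> F \<subseteq> G \<longrightarrow> G = F)"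

definition family_converges_to :: "'a topology \<Rightarrow> 'a set set \<Rightarrow> 'a \<Rightarrow> bool" where
  "family_converges_to X F x \<longleftrightarrow> (\<forall>N. nbhd_of X x N \<longrightarrow> N \<in> F)"

definition bisequential_at :: "'a topology \<Rightarrow> 'a \<Rightarrow> bool" where
  "bisequential_at X x \<longleftrightarrow>
     (\<forall>F. ultrafilter_on (topspace X) F \<and> family_converges_to X F x \<longrightarrow>
        (\<exists>U. decseq U \<and> range U \<subseteq> F \<and> sets_converge_to X U x))"

text \<open>Intersection inside the space, so that the empty intersection is \<^term>\<open>topspace X\<close>.\<close>

definition Inter_in :: "'a topology \<Rightarrow> ('i \<Rightarrow> 'a set) \<Rightarrow> 'i set \<Rightarrow> 'a set" where
  "Inter_in X V S = topspace X \<inter> (\<Inter>\<alpha>\<in>S. V \<alpha>)"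

definition local_base_at :: "'a topology \<Rightarrow> 'a \<Rightarrow> 'a set set \<Rightarrow> bool" where
  "local_base_at X x B \<longleftrightarrow>
     (\<forall>U\<in>B. openin X U \<and> x \<in> U) \<and>
     (\<forall>N. nbhd_of X x N \<longrightarrow> (\<exists>U\<in>B. U \<subseteq> N))"

definition local_subbase_at :: "'a topology \<Rightarrow> 'a \<Rightarrow> 'i set \<Rightarrow> ('i \<Rightarrow> 'a set) \<Rightarrow> bool" where
  "local_subbase_at X x A V \<longleftrightarrow>
     (\<forall>\<alpha>\<in>A. openin X (V \<alpha>) \<and> x \<in> V \<alpha>) \<and>
     local_base_at X x {Inter_in X V S | S. finite S \<and> S \<subseteq> A}"

definition ideal_on :: "'i set \<Rightarrow> 'i set set \<Rightarrow> bool" where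
  "ideal_on A I \<longleftrightarrow>
     I \<subseteq> Pow A \<and> {} \<in> I \<and> A \<notin> I \<and>
     (\<forall>S\<in>I. \<forall>T. T \<subseteq> S \<longrightarrow> T \<in> I) \<and>
     (\<forall>S\<in>I. \<forall>T\<in>I. S \<union> T \<in> I)"

definition finite_intersection_property :: "'a topology \<Rightarrow> 'a set set \<Rightarrow> bool" where
  "finite_intersection_property X F \<longleftrightarrow>
     (\<forall>G. finite G \<and> G \<subseteq> F \<longrightarrow> Inter_in X id G \<noteq> {})"

definition ideal_family ::
    "'a topology \<Rightarrow> 'i set \<Rightarrow> ('i \<Rightarrow> 'a set) \<Rightarrow> 'i set set \<Rightarrow> 'a set set" where
  "ideal_family X A V I =
     {Inter_in X V S | S. S \<in> I} \<union> {topspace X - Inter_in X V S | S. S \<in> Pow A - I}"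

end

theory Submission
  imports Defs
begin

text \<open>
  An ultrafilter \<open>F\<close> converging to \<open>x\<close> and an ideal \<open>I\<close> on the index set of the subbase
  determine each other as far as bisequentiality is concerned: the sets \<open>S\<close> in \<open>I\<close> are those
  whose intersection \<open>Inter_in X V S\<close> belongs to \<open>F\<close>. Given \<open>F\<close>, this is the definition
  of \<open>I\<close>, and \<open>ideal_family X A V I\<close> is then a part of \<open>F\<close>; given \<open>I\<close>, any ultrafilter \<open>F\<close>
  containing \<open>ideal_family X A V I\<close> has this property, and the finite intersection property
  says that such an \<open>F\<close> exists. Convergence of \<open>F\<close> to \<open>x\<close> amounts to \<open>I\<close> containing all
  singletons.

  Under this correspondence, the decreasing sequences in \<open>F\<close> that converge to \<open>x\<close> become the
  countable covers of \<open>A\<close> by members of \<open>I\<close>. From a cover \<open>S\<close>, the sets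
  \<open>Inter_in X V (S 0 \<union> \<dots> \<union> S n)\<close> decrease and eventually enter every finite intersection of the
  subbase, because a finite set of indices is exhausted after finitely many steps
  (\<open>bisequential_of_cover\<close>). From a sequence \<open>U\<close>, the sets \<open>{\<alpha> \<in> A. U n \<subseteq> V \<alpha>}\<close> cover \<open>A\<close>,
  because \<open>U\<close> eventually enters each \<open>V \<alpha>\<close> (\<open>cover_of_bisequential\<close>). Hence an ultrafilter
  witnessing the failure of bisequentiality is the same as an ideal for which no such cover exists.
\<close>

section \<open>Ultrafilters on a set\<close>

lemma proper_filter_on_Int:
  "proper_filter_on T F \<Longrightarrow> P \<in> F \<Longrightarrow> Q \<in> F \<Longrightarrow> P \<inter> Q \<in> F"
  unfolding proper_filter_on_def by simp

lemma proper_filter_on_mono: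
  "proper_filter_on T F \<Longrightarrow> P \<in> F \<Longrightarrow> P \<subseteq> Q \<Longrightarrow> Q \<subseteq> T \<Longrightarrow> Q \<in> F"
  unfolding proper_filter_on_def by simp

lemma filter_generated_by_fip:
  assumes "finite_intersection_property X B" "B \<subseteq> Pow (topspace X)"
  shows "\<exists>F. proper_filter_on (topspace X) F \<and> B \<subseteq> F"
proof -
  define F where "F = {Q. Q \<subseteq> topspace X \<and> (\<exists>G. finite G \<and> G \<subseteq> B \<and> Inter_in X id G \<subseteq> Q)}"
  have FI: "Q \<in> F" if "finite G" "G \<subseteq> B" "Inter_in X id G \<subseteq> Q" "Q \<subseteq> topspace X" for G Q
    using that unfolding F_def by blast
  have "proper_filter_on (topspace X) F"
    unfolding proper_filter_on_def
  proof (intro conjI ballI allI impI)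
    show "F \<subseteq> Pow (topspace X)" unfolding F_def by blast
    show "topspace X \<in> F" by (rule FI[of "{}"]) (simp_all add: Inter_in_def)
    show "{} \<notin> F"
      using assms(1) unfolding F_def finite_intersection_property_def by simp
  next
    fix P Q assume PQ: "P \<in> F" "Q \<in> F"
    obtain G where G: "finite G" "G \<subseteq> B" "Inter_in X id G \<subseteq> P"
      using PQ(1) unfolding F_def by blast
    obtain H where H: "finite H" "H \<subseteq> B" "Inter_in X id H \<subseteq> Q"
      using PQ(2) unfolding F_def by blast
    show "P \<inter> Q \<in> F"
    proof (rule FI)
      show "finite (G \<union> H)" "G \<union> H \<subseteq> B" using G H by simp_all
      show "Inter_in X id (G \<union> H) \<subseteq> P \<inter> Q" using G(3) H(3) unfolding Inter_in_def by blast
      show "P \<inter> Q \<subseteq> topspace X" using PQ(1) unfolding F_def by blast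
    qed
  next
    fix P Q assume "P \<in> F" "P \<subseteq> Q \<and> Q \<subseteq> topspace X"
    then show "Q \<in> F" unfolding F_def by blast
  qed
  moreover have "B \<subseteq> F"
  proof
    fix Q assume "Q \<in> B"
    then show "Q \<in> F" using assms(2) by (intro FI[of "{Q}"]) (auto simp: Inter_in_def)
  qed
  ultimately show ?thesis by blast
qed

lemma proper_filter_on_Union_chain:
  assumes "C \<noteq> {}" "\<And>F. F \<in> C \<Longrightarrow> proper_filter_on T F"
    and "\<And>F G. F \<in> C \<Longrightarrow> G \<in> C \<Longrightarrow> F \<subseteq> G \<or> G \<subseteq> F"
  shows "proper_filter_on T (\<Union>C)"
  unfolding proper_filter_on_def
proof (intro conjI ballI allI impI)
  note flt = assms(2)[unfolded proper_filter_on_def]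
  show "\<Union>C \<subseteq> Pow T" using flt by blast
  show "T \<in> \<Union>C" using assms(1) flt by blast
  show "{} \<notin> \<Union>C" using flt by blast
  fix P assume P: "P \<in> \<Union>C"
  show "Q \<in> \<Union>C" if "P \<subseteq> Q \<and> Q \<subseteq> T" for Q
    using P flt that by blast
  show "P \<inter> Q \<in> \<Union>C" if Q: "Q \<in> \<Union>C" for Q
  proof -
    obtain F G where FG: "F \<in> C" "P \<in> F" "G \<in> C" "Q \<in> G" using P Q by blast
    obtain H where "H \<in> C" "P \<in> H" "Q \<in> H" using assms(3)[OF FG(1,3)] FG by blast
    then show ?thesis using flt[of H] by blast
  qed
qed

lemma ultrafilter_extension:
  assumes "proper_filter_on T F"
  shows "\<exists>U. ultrafilter_on T U \<and> F \<subseteq> U"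
proof -
  let ?E = "{G. proper_filter_on T G \<and> F \<subseteq> G}"
  have "\<exists>M\<in>?E. \<forall>G\<in>?E. M \<subseteq> G \<longrightarrow> G = M"
  proof (rule subset_Zorn_nonempty)
    show "?E \<noteq> {}" using assms by blast
    fix C assume C: "C \<noteq> {}" "subset.chain ?E C"
    then have "proper_filter_on T (\<Union>C)"
      by (intro proper_filter_on_Union_chain) (auto simp: subset_chain_def)
    moreover have "F \<subseteq> \<Union>C" using C unfolding subset_chain_def by blast
    ultimately show "\<Union>C \<in> ?E" by blast
  qed
  then obtain M where "proper_filter_on T M" "F \<subseteq> M"
    and max: "\<And>G. proper_filter_on T G \<Longrightarrow> F \<subseteq> G \<Longrightarrow> M \<subseteq> G \<Longrightarrow> G = M"
    by auto
  then have "ultrafilter_on T M"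
    unfolding ultrafilter_on_def by (metis order_trans)
  with \<open>F \<subseteq> M\<close> show ?thesis by (intro exI conjI)
qed

text \<open>If no member of \<open>F\<close> misses \<open>P\<close>, then \<open>F\<close> and \<open>P\<close> together generate a proper filter,
  which maximality forces to be \<open>F\<close> itself.\<close>

lemma ultrafilter_on_complement:
  assumes "ultrafilter_on T F" "P \<subseteq> T" "P \<notin> F"
  shows "T - P \<in> F"
proof -
  have F: "F \<subseteq> Pow T" "T \<in> F" "\<And>P Q. P \<in> F \<Longrightarrow> Q \<in> F \<Longrightarrow> P \<inter> Q \<in> F"
    "\<And>P Q. P \<in> F \<Longrightarrow> P \<subseteq> Q \<Longrightarrow> Q \<subseteq> T \<Longrightarrow> Q \<in> F"
    using assms(1) unfolding ultrafilter_on_def proper_filter_on_def by auto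
  have max: "\<And>G. proper_filter_on T G \<Longrightarrow> F \<subseteq> G \<Longrightarrow> G = F"
    using assms(1) unfolding ultrafilter_on_def by auto
  define G where "G = {Q. Q \<subseteq> T \<and> (\<exists>R\<in>F. R \<inter> P \<subseteq> Q)}"
  have "F \<subseteq> G" "P \<in> G" using F(1,2) assms(2) unfolding G_def by auto
  then have "\<not> proper_filter_on T G" using max assms(3) by blast
  moreover have "Q \<inter> Q' \<in> G" if Q: "Q \<in> G" "Q' \<in> G" for Q Q'
  proof -
    obtain R R' where "R \<in> F" "R' \<in> F" "R \<inter> P \<subseteq> Q" "R' \<inter> P \<subseteq> Q'"
      using Q unfolding G_def by auto
    then have "R \<inter> R' \<in> F" "R \<inter> R' \<inter> P \<subseteq> Q \<inter> Q'" using F(3) by auto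
    then show ?thesis using Q unfolding G_def by blast
  qed
  moreover have "G \<subseteq> Pow T" "T \<in> G" using F(2) unfolding G_def by auto
  moreover have "\<forall>Q\<in>G. \<forall>Q'. Q \<subseteq> Q' \<and> Q' \<subseteq> T \<longrightarrow> Q' \<in> G"
    unfolding G_def by blast
  ultimately have "{} \<in> G" unfolding proper_filter_on_def by blast
  then obtain R where "R \<in> F" "R \<inter> P = {}" unfolding G_def by auto
  then show ?thesis using F(1) F(4)[of R "T - P"] by blast
qed

section \<open>Intersections of subbasic sets and the neighbourhood filter\<close>

lemma Inter_in_subset: "Inter_in X V S \<subseteq> topspace X"
  unfolding Inter_in_def by blast

lemma Inter_in_antimono: "S \<subseteq> T \<Longrightarrow> Inter_in X V T \<subseteq> Inter_in X V S"
  unfolding Inter_in_def by blast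

lemma Inter_in_Un: "Inter_in X V (S \<union> T) = Inter_in X V S \<inter> Inter_in X V T"
  unfolding Inter_in_def by blast

lemma local_subbase_nbhd:
  assumes "local_subbase_at X x A V" "\<alpha> \<in> A"
  shows "nbhd_of X x (V \<alpha>)"
  using assms openin_subset unfolding local_subbase_at_def nbhd_of_def by blast

lemma local_subbase_finite:
  assumes "local_subbase_at X x A V" "nbhd_of X x N"
  obtains S where "finite S" "S \<subseteq> A" "Inter_in X V S \<subseteq> N"
proof -
  have "local_base_at X x {Inter_in X V S | S. finite S \<and> S \<subseteq> A}"
    using assms(1) unfolding local_subbase_at_def by (rule conjunct2)
  then have "\<exists>W\<in>{Inter_in X V S | S. finite S \<and> S \<subseteq> A}. W \<subseteq> N"
    using assms(2) unfolding local_base_at_def by simp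
  then show ?thesis using that by auto
qed

lemma nbhd_of_subset: "nbhd_of X x N \<Longrightarrow> N \<subseteq> topspace X"
  unfolding nbhd_of_def by blast

section \<open>Convergent sequences and countable covers\<close>

text \<open>A finite set of indices is contained in the union of finitely many of the sets \<open>S i\<close>, so the
  decreasing sequence of intersections over \<open>S 0 \<union> \<dots> \<union> S n\<close> enters every basic neighbourhood.\<close>

lemma bisequential_of_cover:
  fixes S :: "nat \<Rightarrow> 'i set"
  assumes sub: "local_subbase_at X x A V" and F: "proper_filter_on (topspace X) F"
    and S: "\<And>i. Inter_in X V (S i) \<in> F" and cover: "A \<subseteq> (\<Union>i. S i)"
  shows "\<exists>U. decseq U \<and> range U \<subseteq> F \<and> sets_converge_to X U x"
proof -
  define U where "U n = Inter_in X V (\<Union>i\<le>n. S i)" for n :: nat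
  have dec: "decseq U"
    unfolding decseq_def U_def by (intro allI impI Inter_in_antimono) force
  have UF: "U n \<in> F" for n
  proof (induction n)
    case 0
    show ?case using S[of 0] by (simp add: U_def)
  next
    case (Suc n)
    have "U (Suc n) = Inter_in X V (S (Suc n)) \<inter> U n"
      by (simp add: U_def atMost_Suc Inter_in_Un)
    then show ?case using proper_filter_on_Int[OF F S Suc] by simp
  qed
  have "\<exists>n0. \<forall>n>n0. U n \<subseteq> N" if N: "nbhd_of X x N" for N
  proof -
    obtain E where E: "finite E" "E \<subseteq> A" "Inter_in X V E \<subseteq> N"
      using local_subbase_finite[OF sub N] .
    have "\<forall>\<alpha>\<in>E. \<exists>i. \<alpha> \<in> S i" using E(2) cover by blast
    then obtain i where i: "\<And>\<alpha>. \<alpha> \<in> E \<Longrightarrow> \<alpha> \<in> S (i \<alpha>)" by metis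
    have "U n \<subseteq> N" if n: "n > Max (insert 0 (i ` E))" for n
    proof -
      have "i \<alpha> \<le> n" if "\<alpha> \<in> E" for \<alpha>
      proof -
        have "i \<alpha> \<le> Max (insert 0 (i ` E))" using E(1) that by (intro Max_ge) auto
        then show ?thesis using n by simp
      qed
      then have "E \<subseteq> (\<Union>i\<le>n. S i)" using i by blast
      then have "U n \<subseteq> Inter_in X V E" unfolding U_def by (rule Inter_in_antimono)
      then show ?thesis using E(3) by (rule order_trans)
    qed
    then show ?thesis by blast
  qed
  moreover have "U n \<noteq> {} \<and> U n \<subseteq> topspace X" for n
    using UF[of n] F unfolding proper_filter_on_def by auto
  ultimately have "sets_converge_to X U x" unfolding sets_converge_to_def by blast
  then show ?thesis using dec UF by blast
qed

text \<open>The index sets \<open>{\<alpha> \<in> A. U n \<subseteq> V \<alpha>}\<close> are the largest ones whose intersection contains \<open>U n\<close>;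
  each subbasic set is a neighbourhood of \<open>x\<close>, so every index is eventually caught.\<close>

lemma cover_of_bisequential:
  fixes A :: "'i set"
  assumes sub: "local_subbase_at X x A V" and F: "proper_filter_on (topspace X) F"
    and U: "range U \<subseteq> F" "sets_converge_to X U x"
  shows "\<exists>S :: nat \<Rightarrow> 'i set. (\<forall>n. S n \<subseteq> A \<and> Inter_in X V (S n) \<in> F) \<and> (\<Union>n. S n) = A"
proof (intro exI conjI allI)
  let ?S = "\<lambda>n. {\<alpha> \<in> A. U n \<subseteq> V \<alpha>}"
  show "?S n \<subseteq> A" for n by blast
  show "Inter_in X V (?S n) \<in> F" for n
  proof -
    have "U n \<in> F" "U n \<subseteq> topspace X"
      using U unfolding sets_converge_to_def by auto
    then have "U n \<subseteq> Inter_in X V (?S n)" unfolding Inter_in_def by blast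
    with \<open>U n \<in> F\<close> show ?thesis
      using proper_filter_on_mono[OF F _ _ Inter_in_subset] by blast
  qed
  show "(\<Union>n. ?S n) = A"
  proof
    show "A \<subseteq> (\<Union>n. ?S n)"
    proof
      fix \<alpha> assume \<alpha>: "\<alpha> \<in> A"
      then obtain n0 where "\<forall>n>n0. U n \<subseteq> V \<alpha>"
        using U(2) local_subbase_nbhd[OF sub] unfolding sets_converge_to_def by blast
      then have "U (Suc n0) \<subseteq> V \<alpha>" by blast
      then show "\<alpha> \<in> (\<Union>n. ?S n)" using \<alpha> by blast
    qed
  qed blast
qed

section \<open>The ideal of an ultrafilter and the ultrafilters of an ideal\<close>

definition index_ideal ::
    "'a topology \<Rightarrow> 'i set \<Rightarrow> ('i \<Rightarrow> 'a set) \<Rightarrow> 'a set set \<Rightarrow> 'i set set" where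
  "index_ideal X A V F = {S. S \<subseteq> A \<and> Inter_in X V S \<in> F}"

lemma ideal_on_index_ideal:
  assumes F: "proper_filter_on (topspace X) F" and A: "A \<notin> index_ideal X A V F"
  shows "ideal_on A (index_ideal X A V F)"
proof -
  have "T \<in> index_ideal X A V F" if "S \<in> index_ideal X A V F" "T \<subseteq> S" for S T
    using that proper_filter_on_mono[OF F _ Inter_in_antimono[OF that(2)] Inter_in_subset]
    unfolding index_ideal_def by auto
  moreover have "S \<union> T \<in> index_ideal X A V F"
    if "S \<in> index_ideal X A V F" "T \<in> index_ideal X A V F" for S T
    using that proper_filter_on_Int[OF F] unfolding index_ideal_def by (simp add: Inter_in_Un)
  moreover have "{} \<in> index_ideal X A V F"
    using F unfolding proper_filter_on_def index_ideal_def Inter_in_def by simp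
  moreover have "index_ideal X A V F \<subseteq> Pow A"
    unfolding index_ideal_def by blast
  ultimately show ?thesis
    using A unfolding ideal_on_def by (intro conjI ballI allI impI) assumption+
qed

lemma ideal_family_subset_ultrafilter:
  assumes "ultrafilter_on (topspace X) F"
  shows "ideal_family X A V (index_ideal X A V F) \<subseteq> F"
  using ultrafilter_on_complement[OF assms Inter_in_subset]
  unfolding ideal_family_def index_ideal_def by auto

lemma proper_filter_on_fip:
  assumes F: "proper_filter_on (topspace X) F" and "B \<subseteq> F"
  shows "finite_intersection_property X B"
  unfolding finite_intersection_property_def
proof (intro allI impI)
  fix G assume "finite G \<and> G \<subseteq> B"
  then have "finite G" "G \<subseteq> F" using assms(2) by auto
  then have "Inter_in X id G \<in> F"
  proof (induction G)
    case empty
    show ?case using F unfolding proper_filter_on_def Inter_in_def by simp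
  next
    case (insert P G)
    have "Inter_in X id (insert P G) = P \<inter> Inter_in X id G"
      using insert F unfolding proper_filter_on_def Inter_in_def by auto
    moreover have "P \<inter> Inter_in X id G \<in> F"
      using insert by (intro proper_filter_on_Int[OF F]) (simp_all del: id_apply)
    ultimately show ?case by (rule ssubst)
  qed
  then show "Inter_in X id G \<noteq> {}" using F unfolding proper_filter_on_def by auto
qed

text \<open>The complements in \<open>ideal_family X A V I\<close> keep the intersections over sets outside \<open>I\<close> out of
  every proper filter that contains the family.\<close>

lemma index_ideal_of_ideal_family:
  assumes F: "proper_filter_on (topspace X) F" and sub: "ideal_family X A V I \<subseteq> F"
    and I: "I \<subseteq> Pow A"
  shows "index_ideal X A V F = I"
proof
  show "I \<subseteq> index_ideal X A V F"
    using sub I unfolding ideal_family_def index_ideal_def by auto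
  show "index_ideal X A V F \<subseteq> I"
  proof
    fix S assume S: "S \<in> index_ideal X A V F"
    show "S \<in> I"
    proof (rule ccontr)
      assume "S \<notin> I"
      then have "topspace X - Inter_in X V S \<in> F"
        using S sub unfolding ideal_family_def index_ideal_def by blast
      then have "Inter_in X V S \<inter> (topspace X - Inter_in X V S) \<in> F"
        using S proper_filter_on_Int[OF F] unfolding index_ideal_def by blast
      moreover have "Inter_in X V S \<inter> (topspace X - Inter_in X V S) = {}" by blast
      ultimately show False using F unfolding proper_filter_on_def by simp
    qed
  qed
qed

lemma family_converges_iff_singletons:
  assumes sub: "local_subbase_at X x A V" and F: "proper_filter_on (topspace X) F"
  shows "family_converges_to X F x \<longleftrightarrow> (\<forall>\<alpha>\<in>A. {\<alpha>} \<in> index_ideal X A V F)"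
proof
  have V: "Inter_in X V {\<alpha>} = V \<alpha>" if "\<alpha> \<in> A" for \<alpha>
    using nbhd_of_subset[OF local_subbase_nbhd[OF sub that]] unfolding Inter_in_def by auto
  show "\<forall>\<alpha>\<in>A. {\<alpha>} \<in> index_ideal X A V F" if "family_converges_to X F x"
    using that local_subbase_nbhd[OF sub] V
    unfolding family_converges_to_def index_ideal_def by auto
  assume sing: "\<forall>\<alpha>\<in>A. {\<alpha>} \<in> index_ideal X A V F"
  have fin: "Inter_in X V S \<in> F" if "finite S" "S \<subseteq> A" for S
    using that
  proof (induction S)
    case empty
    show ?case using F unfolding proper_filter_on_def Inter_in_def by simp
  next
    case (insert \<alpha> S)
    then have "Inter_in X V {\<alpha>} \<inter> Inter_in X V S \<in> F"
      using sing proper_filter_on_Int[OF F] unfolding index_ideal_def by simp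
    then show ?case using Inter_in_Un[of X V "{\<alpha>}" S] by simp
  qed
  show "family_converges_to X F x"
    unfolding family_converges_to_def
  proof (intro allI impI)
    fix N assume N: "nbhd_of X x N"
    obtain S where "finite S" "S \<subseteq> A" "Inter_in X V S \<subseteq> N"
      using local_subbase_finite[OF sub N] .
    then show "N \<in> F"
      using proper_filter_on_mono[OF F fin _ nbhd_of_subset[OF N]] by blast
  qed
qed

section \<open>The characterization\<close>

theorem theorem3p2:
  fixes X :: "'a topology" and x :: 'a and A :: "'i set" and V :: "'i \<Rightarrow> 'a set"
  assumes "Hausdorff_space X"
    and "completely_regular_space X"
    and "x \<in> topspace X"
    and "local_subbase_at X x A V"
  shows "\<not> bisequential_at X x \<longleftrightarrow>
    (\<exists>I. ideal_on A I \<and>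
       (\<forall>\<alpha>\<in>A. {\<alpha>} \<in> I) \<and>
       finite_intersection_property X (ideal_family X A V I) \<and>
       (\<forall>S :: nat \<Rightarrow> 'i set. range S \<subseteq> I \<longrightarrow> (\<Union>i. S i) \<noteq> A))"
    (is "_ \<longleftrightarrow> (\<exists>I. ?good I)")
proof
  note sub = assms(4)
  assume "\<not> bisequential_at X x"
  then obtain F where uf: "ultrafilter_on (topspace X) F" and conv: "family_converges_to X F x"
    and no: "\<nexists>U. decseq U \<and> range U \<subseteq> F \<and> sets_converge_to X U x"
    unfolding bisequential_at_def by (simp only: not_all not_imp) (elim exE conjE)
  have F: "proper_filter_on (topspace X) F" using uf unfolding ultrafilter_on_def by simp
  let ?I = "index_ideal X A V F"
  have cover: "(\<Union>i. S i) \<noteq> A" if S: "range S \<subseteq> ?I" for S :: "nat \<Rightarrow> 'i set"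
  proof
    assume "(\<Union>i. S i) = A"
    moreover have "Inter_in X V (S i) \<in> F" for i
      using S unfolding index_ideal_def by auto
    ultimately show False using bisequential_of_cover[OF sub F, of S] no by simp
  qed
  \<comment> \<open>The ideal is proper because a constant sequence would otherwise be a countable cover.\<close>
  have "A \<notin> ?I" using cover[of "\<lambda>_. A"] by auto
  then have "ideal_on A ?I" by (rule ideal_on_index_ideal[OF F])
  moreover have "\<forall>\<alpha>\<in>A. {\<alpha>} \<in> ?I"
    using conv family_converges_iff_singletons[OF sub F] by (rule rev_iffD1)
  moreover have "finite_intersection_property X (ideal_family X A V ?I)"
    by (rule proper_filter_on_fip[OF F ideal_family_subset_ultrafilter[OF uf]])
  ultimately show "\<exists>I. ?good I" using cover by (intro exI[of _ ?I] conjI allI impI)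
next
  note sub = assms(4)
  assume "\<exists>I. ?good I"
  then obtain I where I: "ideal_on A I" and sing: "\<forall>\<alpha>\<in>A. {\<alpha>} \<in> I"
    and fip: "finite_intersection_property X (ideal_family X A V I)"
    and cover: "\<forall>S :: nat \<Rightarrow> 'i set. range S \<subseteq> I \<longrightarrow> (\<Union>i. S i) \<noteq> A"
    by (elim exE conjE)
  have "ideal_family X A V I \<subseteq> Pow (topspace X)"
    unfolding ideal_family_def Inter_in_def by auto
  then obtain G where G: "proper_filter_on (topspace X) G" "ideal_family X A V I \<subseteq> G"
    using filter_generated_by_fip[OF fip] by auto
  obtain F where uf: "ultrafilter_on (topspace X) F" and "G \<subseteq> F"
    using ultrafilter_extension[OF G(1)] by auto
  then have le: "ideal_family X A V I \<subseteq> F" using G(2) by simp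
  have F: "proper_filter_on (topspace X) F" using uf unfolding ultrafilter_on_def by simp
  have eq: "index_ideal X A V F = I"
    using I by (intro index_ideal_of_ideal_family[OF F le]) (simp add: ideal_on_def)
  have conv: "family_converges_to X F x"
    using family_converges_iff_singletons[OF sub F] eq sing by simp
  show "\<not> bisequential_at X x"
  proof
    assume "bisequential_at X x"
    then have "\<exists>U. decseq U \<and> range U \<subseteq> F \<and> sets_converge_to X U x"
      using uf conv unfolding bisequential_at_def by simp
    then obtain U where U: "range U \<subseteq> F" "sets_converge_to X U x"
      by (elim exE conjE)
    obtain S :: "nat \<Rightarrow> 'i set"
      where S: "\<And>n. S n \<subseteq> A \<and> Inter_in X V (S n) \<in> F" "(\<Union>n. S n) = A"
      using cover_of_bisequential[OF sub F U] by auto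
    have "range S \<subseteq> index_ideal X A V F" using S(1) unfolding index_ideal_def by auto
    then have "range S \<subseteq> I" unfolding eq .
    then show False using cover S(2) by simp
  qed
qed

end
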